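(* Let $c>1$ be an integer that occurs as a coordinate of some 3-color fair game, i.e. of some triple of non-negative integers $(x_1,x_2,x_3)$ with $(x_1+x_2+x_3)^2-(x_1+x_2+x_3)-4(x_1x_2+x_1x_3+x_2x_3)=0$. Then the number of 3-color fair games (counted up to permutation of coordinates) having $c$ as their largest coordinate is $2^{m-1}$, where $m$ is the number of distinct prime factors of $2c+1$ other than $3$. *)

theory Defs
  imports Complex_Main "HOL-Library.Multiset" "HOL-Computational_Algebra.Primes"
begin

text \<open>The equation is stated over the integers, since subtraction on natural numbers truncates.\<close>

definition fair_game3 :: "nat \<Rightarrow> nat \<Rightarrow> nat \<Rightarrow> bool" where
  "fair_game3 x1 x2 x3 \<longleftrightarrow>
     (int x1 + int x2 + int x3)^2 - (int x1 + int x2 + int x3)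
       - 4 * (int x1 * int x2 + int x1 * int x3 + int x2 * int x3) = 0"

definition occurs_in_fair_game3 :: "nat \<Rightarrow> bool" where
  "occurs_in_fair_game3 c \<longleftrightarrow> (\<exists>x1 x2 x3. fair_game3 x1 x2 x3 \<and> c \<in> {x1, x2, x3})"

text \<open>A triple up to permutation of its coordinates is the multiset of its three coordinates.\<close>

definition fair_games3_with_max :: "nat \<Rightarrow> nat multiset set" where
  "fair_games3_with_max c =
     {{#x1, x2, x3#} | x1 x2 x3. fair_game3 x1 x2 x3 \<and> Max {x1, x2, x3} = c}"

end

theory Submission imports Defs "HOL-Number_Theory.Cong"
begin

text \<open>
  Fixing the coordinate $c$, the equation of a fair game $(a, b, c)$ becomes
  $(2c+1)(a+b) = (a-b)^2 + c^2 - c$, so the game is determined by $d = |a - b|$, and $d$ is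
  subject to $d^2 \equiv c - c^2$ modulo $N = 2c+1$, i.e. $(2d)^2 \equiv -3$. It turns out
  that $c$ is the largest coordinate exactly when $d \le c$. Since $d \mapsto N - d$ is a
  fixed-point free involution on the solutions modulo $N$, the games number half of these
  solutions. If there is one solution, then $9 \nmid N$, the prime 3 contributes a single
  root, and every prime power of another prime contributes two, so by the Chinese remainder
  theorem there are $2^m$ solutions.
\<close>

section \<open>Square roots modulo odd numbers\<close>

text \<open>The right-hand side is the square of a known root \<open>r\<close>, so every count
  starts from an existing solution and solvability never has to be decided.\<close>

definition cong_square_roots :: "nat \<Rightarrow> nat \<Rightarrow> nat set" where
  "cong_square_roots r n = {x. x < n \<and> [x\<^sup>2 = r\<^sup>2] (mod n)}"

lemma finite_cong_square_roots [simp]: "finite (cong_square_roots r n)"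
  by (simp add: cong_square_roots_def)

lemma cong_square_mod_iff:
  fixes x r n :: nat
  assumes "a dvd n"
  shows "[(x mod n)\<^sup>2 = r\<^sup>2] (mod a) \<longleftrightarrow> [x\<^sup>2 = r\<^sup>2] (mod a)"
proof -
  have "[x mod n = x] (mod a)"
    using assms by (simp add: cong_def mod_mod_cancel)
  then have "[(x mod n)\<^sup>2 = x\<^sup>2] (mod a)" by (rule cong_pow)
  then show ?thesis by (meson cong_sym cong_trans)
qed

text \<open>Chinese remainder theorem: reducing modulo \<open>a\<close> and modulo \<open>b\<close>
  is a bijection from the roots modulo \<open>a * b\<close> onto pairs of roots.\<close>

lemma card_cong_square_roots_mult:
  assumes "coprime a b" "a > 0" "b > 0"
  shows "card (cong_square_roots r (a * b)) =
    card (cong_square_roots r a) * card (cong_square_roots r b)"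
proof -
  let ?f = "\<lambda>x. (x mod a, x mod b)"
  have iff: "[x\<^sup>2 = r\<^sup>2] (mod a * b) \<longleftrightarrow> [x\<^sup>2 = r\<^sup>2] (mod a) \<and> [x\<^sup>2 = r\<^sup>2] (mod b)" for x
    using assms(1) by (meson coprime_cong_mult_nat cong_modulus_mult_nat mult.commute cong_def
        cong_dvd_modulus_nat dvd_triv_left dvd_triv_right)
  have "inj_on ?f (cong_square_roots r (a * b))"
  proof (rule inj_onI)
    fix x y
    assume x: "x \<in> cong_square_roots r (a * b)" and y: "y \<in> cong_square_roots r (a * b)"
      and eq: "?f x = ?f y"
    from eq have "[x = y] (mod a)" "[x = y] (mod b)" by (auto simp: cong_def)
    then have "[x = y] (mod a * b)" using assms(1) by (rule coprime_cong_mult_nat)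
    with x y show "x = y" by (simp add: cong_square_roots_def cong_less_modulus_unique_nat)
  qed
  moreover have "?f ` cong_square_roots r (a * b) = cong_square_roots r a \<times> cong_square_roots r b"
  proof (intro equalityI subsetI)
    fix p assume "p \<in> ?f ` cong_square_roots r (a * b)"
    then show "p \<in> cong_square_roots r a \<times> cong_square_roots r b"
      using assms by (auto simp: cong_square_roots_def iff cong_square_mod_iff)
  next
    fix p assume "p \<in> cong_square_roots r a \<times> cong_square_roots r b"
    then obtain u v where p: "p = (u, v)" "u < a" "v < b"
        "[u\<^sup>2 = r\<^sup>2] (mod a)" "[v\<^sup>2 = r\<^sup>2] (mod b)"
      by (auto simp: cong_square_roots_def)
    obtain x where x: "[x = u] (mod a)" "[x = v] (mod b)"
      using binary_chinese_remainder_nat[OF assms(1)] by blast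
    have "[x\<^sup>2 = r\<^sup>2] (mod a)" "[x\<^sup>2 = r\<^sup>2] (mod b)"
      using x p cong_pow cong_trans by blast+
    then have "x mod (a * b) \<in> cong_square_roots r (a * b)"
      using assms by (simp add: cong_square_roots_def cong_square_mod_iff iff)
    moreover have "p = ?f (x mod (a * b))"
      using x p by (simp add: cong_def mod_mod_cancel)
    ultimately show "p \<in> ?f ` cong_square_roots r (a * b)" by (rule rev_image_eqI)
  qed
  ultimately show ?thesis
    by (metis card_image card_cartesian_product)
qed

text \<open>The roots are \<open>r\<close> and \<open>- r\<close> only: \<open>p\<close> cannot
  divide both \<open>x - r\<close> and \<open>x + r\<close>, as it would divide
  \<open>2 * r\<close>, so the whole power \<open>p ^ k\<close> divides one of them.\<close>

lemma card_cong_square_roots_prime_power: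
  assumes p: "prime p" "odd p" and r: "\<not> p dvd r" and k: "k > 0"
  shows "card (cong_square_roots r (p ^ k)) = 2"
proof -
  define q where "q = p ^ k"
  \<comment> \<open>With the reduced representative the two roots are \<open>s\<close> and
    \<open>q - s\<close>; positivity of \<open>s\<close> keeps \<open>q - s\<close> below
    \<open>q\<close>.\<close>
  define s where "s = r mod q"
  have "p dvd q" using k by (simp add: q_def)
  have "\<not> p dvd s" using r \<open>p dvd q\<close> by (simp add: s_def dvd_mod_iff)
  then have "s > 0" by (metis dvd_0_right gr0I)
  have "q > 0" using p by (simp add: q_def prime_gt_0_nat)
  then have "s < q" by (simp add: s_def)
  have "odd q" using p by (simp add: q_def)
  have sq: "[x\<^sup>2 = r\<^sup>2] (mod q) \<longleftrightarrow> int q dvd (int x - int s) * (int x + int s)" for x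
  proof -
    have "[s\<^sup>2 = r\<^sup>2] (mod q)" by (simp add: s_def cong_square_mod_iff)
    then have "[x\<^sup>2 = r\<^sup>2] (mod q) \<longleftrightarrow> [x\<^sup>2 = s\<^sup>2] (mod q)" by (meson cong_sym cong_trans)
    also have "\<dots> \<longleftrightarrow> int q dvd (int x)\<^sup>2 - (int s)\<^sup>2"
      by (simp flip: cong_int_iff add: cong_iff_dvd_diff)
    finally show ?thesis by (simp add: power2_eq_square algebra_simps)
  qed
  have "cong_square_roots r q = {s, q - s}"
  proof (intro equalityI subsetI)
    fix x assume "x \<in> cong_square_roots r q"
    then have x: "x < q" and d: "int q dvd (int x - int s) * (int x + int s)"
      by (auto simp: cong_square_roots_def sq)
    have "\<not> (int p dvd int x - int s \<and> int p dvd int x + int s)"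
    proof
      assume "int p dvd int x - int s \<and> int p dvd int x + int s"
      then have "int p dvd (int x + int s) - (int x - int s)" using dvd_diff by blast
      then have "int p dvd int (2 * s)" by simp
      then have "p dvd 2 * s" by (simp only: int_dvd_int_iff)
      then show False using p \<open>\<not> p dvd s\<close>
        by (metis prime_dvd_mult_iff primes_dvd_imp_eq two_is_prime_nat)
    qed
    then have "coprime (int q) (int x - int s) \<or> coprime (int q) (int x + int s)"
      using p by (auto simp: q_def prime_imp_coprime)
    then have "int q dvd int x - int s \<or> int q dvd int x + int s"
      using d by (auto simp: coprime_dvd_mult_left_iff coprime_dvd_mult_right_iff)
    then show "x \<in> {s, q - s}"
    proof
      assume "int q dvd int x - int s"
      then have "[x = s] (mod q)" by (simp flip: cong_int_iff add: cong_iff_dvd_diff)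
      with x \<open>s < q\<close> show ?thesis by (simp add: cong_less_modulus_unique_nat)
    next
      assume "int q dvd int x + int s"
      then obtain t where t: "int x + int s = int q * t" by auto
      \<comment> \<open>Since \<open>x + s\<close> is a multiple of \<open>q\<close> strictly
        between 0 and \<open>2 * q\<close>, it equals \<open>q\<close>.\<close>
      have "0 < int q * t" "int q * t < int q * 2"
        using t x \<open>s > 0\<close> \<open>s < q\<close> by linarith+
      then have "t = 1" using \<open>q > 0\<close> by (simp add: zero_less_mult_iff)
      with t show ?thesis by auto
    qed
  next
    fix x assume "x \<in> {s, q - s}"
    then show "x \<in> cong_square_roots r q"
      using \<open>s > 0\<close> \<open>s < q\<close> by (auto simp: cong_square_roots_def sq)
  qed
  moreover have "s \<noteq> q - s" using \<open>odd q\<close> \<open>s < q\<close> by presburger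
  ultimately show ?thesis by (simp add: q_def)
qed

text \<open>Induction splits off the full power of one prime \<open>p\<close>: it contributes a
  factor 2, and the cofactor \<open>t\<close> loses exactly the prime \<open>p\<close>.\<close>

lemma card_cong_square_roots_coprime:
  assumes "odd n" "coprime r n"
  shows "card (cong_square_roots r n) = 2 ^ card (prime_factors n)"
  using assms
proof (induction n rule: less_induct)
  case (less n)
  have "n > 0" using less.prems by (auto intro: Nat.gr0I)
  show ?case
  proof (cases "n = 1")
    case True
    then have "cong_square_roots r n = {0}" by (auto simp: cong_square_roots_def)
    with True show ?thesis by simp
  next
    case False
    then obtain p where p: "prime p" "p dvd n" using prime_factor_nat by blast
    define k where "k = multiplicity p n"
    have "k > 0" using p \<open>n > 0\<close> by (simp add: k_def prime_multiplicity_gt_zero_iff)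
    obtain t where t: "n = p ^ k * t" "\<not> p dvd t"
      using multiplicity_decompose'[of n p] p \<open>n > 0\<close> not_prime_unit unfolding k_def by blast
    have "t > 0" using t \<open>n > 0\<close> by auto
    have cop: "coprime (p ^ k) t" using p t by (simp add: prime_imp_coprime)
    have "p ^ k > 1" using p \<open>k > 0\<close> by (intro one_less_power prime_gt_1_nat)
    then have "t < n" using t \<open>t > 0\<close> by simp
    have "odd p" "odd t" using less.prems t p \<open>k > 0\<close> by auto
    have "\<not> p dvd r" using less.prems p by (meson coprime_common_divisor not_prime_unit)
    have "coprime r t" using less.prems t by simp
    have "prime_factors n = insert p (prime_factors t)"
      using p t \<open>t > 0\<close> \<open>k > 0\<close>
      by (simp add: prime_factors_product prime_factorization_prime_power)
    moreover have "p \<notin> prime_factors t" using t by auto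
    ultimately have "card (prime_factors n) = Suc (card (prime_factors t))" by simp
    moreover have "card (cong_square_roots r n) = 2 * 2 ^ card (prime_factors t)"
      using card_cong_square_roots_mult[OF cop, of r] t \<open>t > 0\<close> p \<open>odd p\<close> \<open>\<not> p dvd r\<close> \<open>k > 0\<close>
        less.IH[OF \<open>t < n\<close> \<open>odd t\<close> \<open>coprime r t\<close>]
      by (simp add: card_cong_square_roots_prime_power prime_gt_0_nat)
    ultimately show ?thesis by simp
  qed
qed

section \<open>Roots when -3 is the square of \<open>2 * r\<close>, and their pairing by
  negation\<close>

text \<open>A common prime of \<open>n\<close> and \<open>r\<close> divides 3, so only the prime 3
  can spoil coprimality. It divides \<open>n\<close> at most once, and splitting it off leaves the
  coprime case.\<close>

lemma card_cong_square_roots_minus_three: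
  assumes "odd n" and dvd: "n dvd 4 * r\<^sup>2 + 3"
  shows "card (cong_square_roots r n) = 2 ^ card (prime_factors n - {3})"
proof -
  have p3: "prime (3::nat)" by simp
  have common: "p = 3" if "prime p" "p dvd n" "p dvd r" for p
  proof -
    have "p dvd 4 * r\<^sup>2 + 3" using that dvd dvd_trans by blast
    moreover have "p dvd 4 * r\<^sup>2" using that by (simp add: power2_eq_square)
    ultimately have "p dvd 3" using dvd_add_right_iff by blast
    then show ?thesis using that p3 by (simp add: primes_dvd_imp_eq)
  qed
  have coprime_if: "coprime r t" if "t dvd n" "\<not> 3 dvd t" for t
  proof -
    have "gcd r t = 1"
    proof (rule ccontr)
      assume "gcd r t \<noteq> 1"
      then obtain p where p: "prime p" "p dvd gcd r t" using prime_factor_nat by blast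
      then have "p dvd r" "p dvd t" by auto
      then show False using common p that dvd_trans by blast
    qed
    then show ?thesis by (simp add: coprime_iff_gcd_eq_1)
  qed
  show ?thesis
  proof (cases "3 dvd n")
    case False
    then have "coprime r n" by (intro coprime_if dvd_refl)
    moreover have "prime_factors n - {3} = prime_factors n" using False by auto
    ultimately show ?thesis using assms card_cong_square_roots_coprime by simp
  next
    case True
    then obtain t where t: "n = 3 * t" by blast
    have "t > 0" using \<open>odd n\<close> t by (auto intro: Nat.gr0I)
    have "3 dvd 4 * r\<^sup>2 + 3" using True dvd dvd_trans by blast
    then have "3 dvd 4 * r\<^sup>2" by (simp add: dvd_add_left_iff)
    moreover have "coprime 3 (4::nat)" by (simp add: coprime_iff_gcd_eq_1 gcd_non_0_nat)
    ultimately have "3 dvd r\<^sup>2" by (simp only: coprime_dvd_mult_right_iff)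
    then have "3 dvd r" using p3 by (rule prime_dvd_power[rotated])
    then obtain u where u: "r = 3 * u" by blast
    \<comment> \<open>As \<open>3 dvd r\<close>, the number \<open>4 * r\<^sup>2 + 3\<close> is 3
      modulo 9, so 9 cannot divide \<open>n\<close>.\<close>
    have "\<not> 3 dvd t"
    proof
      assume "3 dvd t"
      then have "9 dvd n" using t by auto
      then have "9 dvd 36 * u\<^sup>2 + 3" using dvd u dvd_trans by (fastforce simp: power2_eq_square)
      then show False by presburger
    qed
    then have cop: "coprime 3 t" using p3 by (simp add: prime_imp_coprime)
    have "coprime r t" using coprime_if t \<open>\<not> 3 dvd t\<close> by simp
    then have card_t: "card (cong_square_roots r t) = 2 ^ card (prime_factors t)"
      using card_cong_square_roots_coprime \<open>odd n\<close> t by simp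
    have "prime_factors n - {3} = prime_factors t"
      using t \<open>t > 0\<close> \<open>\<not> 3 dvd t\<close> p3
      by (auto simp: prime_factors_product prime_prime_factors)
    \<comment> \<open>Modulo 3 the root \<open>r\<close> vanishes and coincides with its negative,
      so this factor contributes 1 instead of 2.\<close>
    moreover have "cong_square_roots r 3 = {0}"
    proof -
      have "[x\<^sup>2 = r\<^sup>2] (mod 3) \<longleftrightarrow> 3 dvd x" for x
      proof -
        have "[x\<^sup>2 = r\<^sup>2] (mod 3) \<longleftrightarrow> 3 dvd x\<^sup>2"
          using \<open>3 dvd r\<close> by (simp add: cong_def power2_eq_square mod_eq_0_iff_dvd)
        then show ?thesis using p3 by (simp add: prime_dvd_power_iff)
      qed
      then show ?thesis by (auto simp: cong_square_roots_def dest: dvd_imp_le)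
    qed
    ultimately show ?thesis
      using card_cong_square_roots_mult[OF cop, of r] t \<open>t > 0\<close> card_t by simp
  qed
qed

text \<open>Negation \<open>d \<mapsto> n - d\<close> swaps the roots in \<open>1..c\<close> with
  those in \<open>c + 1..2 * c\<close>. The hypothesis excludes the root 0, whose partner would be
  \<open>n\<close> itself.\<close>

lemma card_cong_square_roots_half:
  assumes "\<not> 2 * c + 1 dvd r\<^sup>2"
  shows "card (cong_square_roots r (2 * c + 1)) =
    2 * card {d. d \<le> c \<and> [d\<^sup>2 = r\<^sup>2] (mod 2 * c + 1)}"
proof -
  define n where "n = 2 * c + 1"
  define D where "D = {d. d \<le> c \<and> [d\<^sup>2 = r\<^sup>2] (mod n)}"
  have neg: "[(n - d)\<^sup>2 = r\<^sup>2] (mod n) \<longleftrightarrow> [d\<^sup>2 = r\<^sup>2] (mod n)" if "d \<le> n" for d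
  proof -
    have "(int n - int d)\<^sup>2 - (int d)\<^sup>2 = int n * (int n - 2 * int d)"
      by (simp add: power2_eq_square algebra_simps)
    then have "[(int n - int d)\<^sup>2 = (int d)\<^sup>2] (mod int n)"
      by (simp add: cong_iff_dvd_diff)
    then have "[(n - d)\<^sup>2 = d\<^sup>2] (mod n)"
      using that by (simp flip: cong_int_iff)
    then show ?thesis by (meson cong_sym cong_trans)
  qed
  have pos: "0 < d" if "d \<in> D" for d
    using that assms by (auto intro!: Nat.gr0I simp: D_def n_def cong_def mod_eq_0_iff_dvd)
  have "cong_square_roots r n = D \<union> (\<lambda>d. n - d) ` D"
  proof (intro equalityI subsetI)
    fix x assume x: "x \<in> cong_square_roots r n"
    show "x \<in> D \<union> (\<lambda>d. n - d) ` D"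
    proof (cases "x \<le> c")
      case True
      with x show ?thesis by (simp add: D_def cong_square_roots_def)
    next
      case False
      with x have "n - x \<le> c" "x = n - (n - x)" "[(n - x)\<^sup>2 = r\<^sup>2] (mod n)"
        using neg[of x] by (auto simp: cong_square_roots_def n_def)
      then have "n - x \<in> D" by (simp add: D_def)
      with \<open>x = n - (n - x)\<close> show ?thesis by blast
    qed
  next
    fix x assume "x \<in> D \<union> (\<lambda>d. n - d) ` D"
    then obtain d where d: "d \<in> D" "x = d \<or> x = n - d" by auto
    then have "d \<le> c" "[d\<^sup>2 = r\<^sup>2] (mod n)" by (auto simp: D_def)
    moreover from this have "d < n" by (simp add: n_def)
    ultimately show "x \<in> cong_square_roots r n"
      using pos[OF d(1)] d(2) neg[of d] by (auto simp: cong_square_roots_def)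
  qed
  moreover have "D \<inter> (\<lambda>d. n - d) ` D = {}" by (auto simp: D_def n_def)
  moreover have "card ((\<lambda>d. n - d) ` D) = card D"
    by (rule card_image) (auto simp: inj_on_def D_def n_def)
  moreover have "finite D" by (simp add: D_def)
  ultimately have "card (cong_square_roots r n) = 2 * card D" by (simp add: card_Un_disjoint)
  then show ?thesis by (simp add: D_def n_def)
qed

section \<open>Fair games with a given coordinate\<close>

text \<open>With \<open>c\<close> fixed, this form shows the divisibility condition on
  \<open>b - a\<close> and recovers \<open>a + b\<close> from it.\<close>

lemma fair_game3_iff:
  "fair_game3 a b c \<longleftrightarrow>
    (int b - int a)\<^sup>2 + (int c)\<^sup>2 - int c = (2 * int c + 1) * (int a + int b)"
  unfolding fair_game3_def by (simp add: power2_eq_square algebra_simps)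

lemma fair_game3_rotate: "fair_game3 a b c \<longleftrightarrow> fair_game3 b c a"
  unfolding fair_game3_def by (simp add: power2_eq_square algebra_simps)

lemma fair_game3_swap: "fair_game3 a b c \<longleftrightarrow> fair_game3 b a c"
  unfolding fair_game3_def by (simp add: power2_eq_square algebra_simps)

lemma occurs_in_fair_game3_obtain:
  assumes "occurs_in_fair_game3 c"
  obtains a b where "fair_game3 a b c" "a \<le> b"
  using assms unfolding occurs_in_fair_game3_def
  by (auto; metis fair_game3_rotate fair_game3_swap nle_le)

text \<open>Symmetry of the equation lets a largest coordinate be moved to the last place and the
  other two be sorted.\<close>

lemma fair_games3_with_max_eq_image:
  "fair_games3_with_max c =
    (\<lambda>(a, b). {#a, b, c#}) ` {(a, b). a \<le> b \<and> b \<le> c \<and> fair_game3 a b c}"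
    (is "_ = ?f ` ?P")
proof (intro equalityI subsetI)
  fix M assume "M \<in> fair_games3_with_max c"
  then obtain x y z where M: "M = {#x, y, z#}" "fair_game3 x y z" "Max {x, y, z} = c"
    by (auto simp: fair_games3_with_max_def)
  then have "c \<in> {x, y, z}" and le: "x \<le> c" "y \<le> c" "z \<le> c"
    using Max_in[of "{x, y, z}"] by auto
  then obtain a b where ab: "M = {#a, b, c#}" "fair_game3 a b c" "a \<le> c" "b \<le> c"
  proof -
    consider "x = c" | "y = c" | "z = c" using \<open>c \<in> {x, y, z}\<close> by auto
    then show ?thesis
    proof cases
      case 1
      then show ?thesis using M le that[of y z] fair_game3_rotate[of x]
        by (simp add: add_mset_commute)
    next
      case 2
      then show ?thesis using M le that[of z x] fair_game3_rotate[of z]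
        by (simp add: add_mset_commute)
    next
      case 3
      then show ?thesis using M le that[of x y] by simp
    qed
  qed
  show "M \<in> ?f ` ?P"
  proof (cases "a \<le> b")
    case True
    then show ?thesis using ab by auto
  next
    case False
    then have "(b, a) \<in> ?P" using ab fair_game3_swap by auto
    moreover have "M = ?f (b, a)" using ab by (simp add: add_mset_commute)
    ultimately show ?thesis by (rule rev_image_eqI)
  qed
next
  fix M assume "M \<in> ?f ` ?P"
  then obtain a b where "M = {#a, b, c#}" "a \<le> b" "b \<le> c" "fair_game3 a b c" by auto
  moreover from this have "Max {a, b, c} = c" by simp
  ultimately show "M \<in> fair_games3_with_max c" unfolding fair_games3_with_max_def by blast
qed

lemma card_fair_games3_with_max:
  "card (fair_games3_with_max c) = card {(a, b). a \<le> b \<and> b \<le> c \<and> fair_game3 a b c}"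
  unfolding fair_games3_with_max_eq_image
proof (rule card_image, rule inj_onI)
  fix p q
  assume "p \<in> {(a, b). a \<le> b \<and> b \<le> c \<and> fair_game3 a b c}"
    and "q \<in> {(a, b). a \<le> b \<and> b \<le> c \<and> fair_game3 a b c}"
    and eq: "(\<lambda>(a, b). {#a, b, c#}) p = (\<lambda>(a, b). {#a, b, c#}) q"
  then obtain a b a' b' where pq: "p = (a, b)" "q = (a', b')" "a \<le> b" "a' \<le> b'" by auto
  \<comment> \<open>Isolating \<open>c\<close> allows it to be cancelled; sorted pairs with the same
    multiset are then equal.\<close>
  have "{#x, y, c#} = {#x, y#} + {#c#}" for x y by simp
  with eq have "{#a, b#} = {#a', b'#}" unfolding pq prod.case by (simp only: add_right_cancel)
  with pq show "p = q" by (auto simp: add_eq_conv_diff)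
qed

section \<open>Parametrizing games by the difference of the smaller coordinates\<close>

text \<open>Injectivity holds because the equation gives \<open>a + b\<close> from
  \<open>b - a\<close>. For surjectivity the quotient \<open>s\<close> serves as
  \<open>a + b\<close>; parity makes \<open>a\<close> an integer, and \<open>d \<le> c\<close>
  yields both \<open>0 \<le> a\<close> and \<open>b \<le> c\<close>.\<close>

lemma bij_betw_fair_game3_difference:
  "bij_betw (\<lambda>(a, b). b - a) {(a, b). a \<le> b \<and> b \<le> c \<and> fair_game3 a b c}
    {d. d \<le> c \<and> (2 * int c + 1) dvd (int d)\<^sup>2 + (int c)\<^sup>2 - int c}"
    (is "bij_betw ?f ?P ?D")
  unfolding bij_betw_def
proof (intro conjI equalityI subsetI)
  show "inj_on ?f ?P"
  proof (rule inj_onI, clarsimp)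
    fix a b a' b' :: nat
    assume le: "a \<le> b" "a' \<le> b'" and g: "fair_game3 a b c" "fair_game3 a' b' c"
      and eq: "b - a = b' - a'"
    then have d: "int b - int a = int b' - int a'" by linarith
    with g have "(2 * int c + 1) * (int a + int b) = (2 * int c + 1) * (int a' + int b')"
      by (simp add: fair_game3_iff)
    moreover have "2 * int c + 1 \<noteq> 0" by linarith
    ultimately have "int a + int b = int a' + int b'" by (simp only: mult_cancel_left) simp
    with d show "a = a' \<and> b = b'" by linarith
  qed
next
  fix d assume "d \<in> ?f ` ?P"
  then show "d \<in> ?D" by (auto simp: fair_game3_iff)
next
  fix d assume "d \<in> ?D"
  then obtain s where dc: "d \<le> c"
    and s: "(int d)\<^sup>2 + (int c)\<^sup>2 - int c = (2 * int c + 1) * s" by auto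
  define N where "N = 2 * int c + 1"
  have "N > 0" by (simp add: N_def)
  \<comment> \<open>The product of \<open>c\<close> and \<open>c - 1\<close> is even, and
    \<open>2 * c + 1\<close> is odd, so \<open>s\<close> has the parity of \<open>d\<close> and
    \<open>(s - d) / 2\<close> is an integer.\<close>
  have "even ((int d)\<^sup>2 + (int c)\<^sup>2 - int c) \<longleftrightarrow> even d" by simp blast
  then have "even (s - int d)" by (simp add: s)
  then obtain a where a: "s = int d + 2 * a"
    by (metis diff_add_cancel evenE add.commute)
  \<comment> \<open>The bound below is only $2aN \ge -2c > -N$, but $a$ is an integer.\<close>
  have "N * (2 * a) = (int c - int d) * (int c + 1 - int d) - 2 * int c"
    using s unfolding a N_def by (simp add: power2_eq_square algebra_simps)
  moreover have "(int c - int d) * (int c + 1 - int d) \<ge> 0" using dc by simp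
  ultimately have "N * (2 * a) > N * (-1)" by (simp add: N_def)
  then have "a \<ge> 0" using \<open>N > 0\<close> by (simp only: mult_less_cancel_left_pos)
  \<comment> \<open>The larger coordinate is \<open>a + d\<close>. Subtracting the formula for
    \<open>N * (2 * a)\<close> from \<open>N * (2 * (c - d))\<close> gives its distance to
    \<open>c\<close>.\<close>
  have "N * (2 * (int c - a - int d)) =
      (int c - int d) * (3 * int c + int d + 1) + 2 * int c"
    using s unfolding a N_def by (simp add: power2_eq_square algebra_simps)
  also have "\<dots> \<ge> 0" using dc by simp
  finally have "a + int d \<le> int c" using \<open>N > 0\<close> by (simp add: zero_le_mult_iff)
  obtain k where k: "a = int k" using \<open>a \<ge> 0\<close> nonneg_int_cases by blast
  have "fair_game3 k (k + d) c" using s unfolding a k fair_game3_iff by (simp add: algebra_simps)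
  moreover have "k + d \<le> c" using \<open>a + int d \<le> int c\<close> k by simp
  ultimately have "(k, k + d) \<in> ?P" by simp
  then show "d \<in> ?f ` ?P" by (rule rev_image_eqI) simp
qed

section \<open>The number of games with largest coordinate \<open>c\<close>\<close>

theorem theorem5p5:
  fixes c m :: nat
  assumes "c > 1"
    and "occurs_in_fair_game3 c"
    and "m = card (prime_factors (2 * c + 1) - {3})"
  shows "real (card (fair_games3_with_max c)) = 2 powi (int m - 1)"
proof -
  define n where "n = 2 * c + 1"
  have N: "int n = 2 * int c + 1" by (simp add: n_def)
  obtain a b where ab: "fair_game3 a b c" "a \<le> b"
    using occurs_in_fair_game3_obtain assms(2) by blast
  \<comment> \<open>This game supplies the known root. Its largest coordinate need not be
    \<open>c\<close>, so \<open>r\<close> may exceed \<open>c\<close>.\<close>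
  define r where "r = b - a"
  have r: "int n dvd (int r)\<^sup>2 + (int c)\<^sup>2 - int c"
    using ab by (simp add: r_def N fair_game3_iff)
  \<comment> \<open>The multiplier comes from dividing \<open>4 * c\<^sup>2 - 4 * c\<close> by
    \<open>2 * c + 1\<close>: the quotient is \<open>2 * c - 3\<close> and the remainder 3.\<close>
  have "int n dvd 4 * ((int r)\<^sup>2 + (int c)\<^sup>2 - int c) - int n * (2 * int c - 3)"
    using r by (meson dvd_diff dvd_mult dvd_triv_left)
  also have "\<dots> = int (4 * r\<^sup>2 + 3)" by (simp add: N power2_eq_square algebra_simps)
  finally have n_dvd: "n dvd 4 * r\<^sup>2 + 3" by (simp only: int_dvd_int_iff)
  \<comment> \<open>Here \<open>c > 1\<close> enters: \<open>n\<close> is at least 5 and cannot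
    divide 3. Hence 0 is not a root.\<close>
  have "\<not> n dvd r\<^sup>2"
  proof
    assume "n dvd r\<^sup>2"
    then have "n dvd 3" using n_dvd by (simp add: dvd_add_right_iff)
    then show False using assms(1) by (auto simp: n_def dest: dvd_imp_le)
  qed
  have "[d\<^sup>2 = r\<^sup>2] (mod n) \<longleftrightarrow> int n dvd (int d)\<^sup>2 + (int c)\<^sup>2 - int c" for d
  proof -
    have "[d\<^sup>2 = r\<^sup>2] (mod n) \<longleftrightarrow> int n dvd (int d)\<^sup>2 - (int r)\<^sup>2"
      by (simp flip: cong_int_iff add: cong_iff_dvd_diff)
    also have "\<dots> \<longleftrightarrow> int n dvd ((int d)\<^sup>2 - (int r)\<^sup>2) + ((int r)\<^sup>2 + (int c)\<^sup>2 - int c)"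
      using r by (simp only: dvd_add_left_iff)
    finally show ?thesis by (simp add: algebra_simps)
  qed
  then have "card (fair_games3_with_max c) = card {d. d \<le> c \<and> [d\<^sup>2 = r\<^sup>2] (mod n)}"
    using card_fair_games3_with_max bij_betw_same_card[OF bij_betw_fair_game3_difference]
    by (simp add: N)
  then have "2 * card (fair_games3_with_max c) = card (cong_square_roots r n)"
    using card_cong_square_roots_half \<open>\<not> n dvd r\<^sup>2\<close> by (simp add: n_def)
  also have "\<dots> = 2 ^ m"
    using card_cong_square_roots_minus_three[OF _ n_dvd] assms(3) by (simp add: n_def)
  finally have "real (2 * card (fair_games3_with_max c)) = 2 ^ m" by simp
  \<comment> \<open>Halving takes place in the reals, where it lowers the integer exponent by
    one.\<close>
  then show ?thesis by (simp add: power_int_diff)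
qed

end
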